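(* Let $G=([n],E)$ be a simple graph on vertex set $[n]$, and let $\sigma\in S_n$ have cycle decomposition $\sigma=\sigma_1\cdots\sigma_m$ (fixed points included as $1$-cycles, each cycle identified with its set of elements, so the $\sigma_k$ partition $[n]$). Then the vertex set of $\mathrm{SEP}(G)^\sigma$ is $$\left\{\frac{1}{|\sigma_i|}\mathbf{e}_{\sigma_i}-\frac{1}{|\sigma_j|}\mathbf{e}_{\sigma_j} : i\neq j,\ \{a,b\}\in E\text{ for some }a\in\sigma_i\text{ and }b\in\sigma_j\right\}.$$
   Context: $\mathrm{SEP}(G)=\operatorname{conv}\{\pm(\mathbf{e}_i-\mathbf{e}_j)\in\mathbb{R}^n:\{i,j\}\in E\}$, with $\mathbf{e}_i$ the standard basis vectors, and for $S\subseteq[n]$, $\mathbf{e}_S=\sum_{i\in S}\mathbf{e}_i$. $S_n$ acts on $\mathbb{R}^n$ by $\sigma\cdot\mathbf{e}_i=\mathbf{e}_{\sigma(i)}$, and $P^\sigma=\{\mathbf{x}\in P:\sigma\cdot\mathbf{x}=\mathbf{x}\}$ is the fixed polytope.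
   Formalization: The formal theorem assumes that σ is an automorphism of G (not an arbitrary element of S_n) and that either E is empty or some edge joins two distinct cycles of σ; the claim fails for G = {{1,2}} with σ = (2 3), n = 3, and with σ = (1 2), n = 2. *)

theory Defs
  imports "HOL-Analysis.Analysis" "HOL-Combinatorics.Combinatorics"
begin

text \<open>The vertex set \<open>[n]\<close> is the universe of a finite index type \<open>'n\<close>, and an edge is a
  two-element set of vertices.\<close>

definition simple_graph :: "'n set set \<Rightarrow> bool" where
  "simple_graph E \<longleftrightarrow> (\<forall>e\<in>E. card e = 2)"

definition graph_automorphism :: "'n set set \<Rightarrow> ('n \<Rightarrow> 'n) \<Rightarrow> bool" where
  "graph_automorphism E \<sigma> \<longleftrightarrow>
     \<sigma> permutes UNIV \<and> (\<forall>a b. {\<sigma> a, \<sigma> b} \<in> E \<longleftrightarrow> {a, b} \<in> E)"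

definition evec :: "'n set \<Rightarrow> real ^ 'n::finite" where
  "evec S = (\<Sum>i\<in>S. axis i 1)"

definition SEP :: "'n::finite set set \<Rightarrow> (real ^ 'n) set" where
  "SEP E = convex hull
     {v. \<exists>i j. {i, j} \<in> E \<and> (v = axis i 1 - axis j 1 \<or> v = - (axis i 1 - axis j 1))}"

text \<open>The linear extension of \<open>\<sigma> \<cdot> e\<^sub>i = e\<^bsub>\<sigma>(i)\<^esub>\<close>.\<close>

definition perm_act :: "('n \<Rightarrow> 'n) \<Rightarrow> real ^ 'n::finite \<Rightarrow> real ^ 'n" where
  "perm_act \<sigma> x = (\<Sum>i\<in>UNIV. x $ i *\<^sub>R axis (\<sigma> i) 1)"

definition fixed_polytope :: "(real ^ 'n::finite) set \<Rightarrow> ('n \<Rightarrow> 'n) \<Rightarrow> (real ^ 'n) set" where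
  "fixed_polytope P \<sigma> = {x \<in> P. perm_act \<sigma> x = x}"

definition vertex_set :: "(real ^ 'n::finite) set \<Rightarrow> (real ^ 'n) set" where
  "vertex_set P = {v. v extreme_point_of P}"

text \<open>For a permutation of a finite type the orbits are the supports of the cycles, with a fixed
  point \<open>a\<close> contributing \<open>{a}\<close>.\<close>

definition cycle_sets :: "('n \<Rightarrow> 'n) \<Rightarrow> 'n set set" where
  "cycle_sets \<sigma> = range (orbit \<sigma>)"

definition joined :: "'n set set \<Rightarrow> 'n set \<Rightarrow> 'n set \<Rightarrow> bool" where
  "joined E C D \<longleftrightarrow> (\<exists>a\<in>C. \<exists>b\<in>D. {a, b} \<in> E)"

end

theory Submission
  imports Defs
begin

text \<open>Averaging over the cycles of \<open>\<sigma>\<close> coincides with averaging over the powers of \<open>\<sigma>\<close>, so it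
  maps the \<open>\<sigma>\<close>-invariant polytope \<open>SEP E\<close> onto its fixed polytope. The latter is therefore the
  convex hull of the averaged generators, which are differences of cycle barycentres, together
  with \<open>0\<close> if some edge lies within a cycle; \<open>0\<close> is redundant because the remaining generators
  form a nonempty set symmetric about the origin. The generator belonging to \<open>(C, D)\<close> is a vertex
  since it is the only one at which the functional \<open>\<Sum>\<^bsub>i\<in>C\<^esub> x\<^sub>i - \<Sum>\<^bsub>i\<in>D\<^esub> x\<^sub>i\<close> attains the value 2.\<close>

subsection \<open>The permutation action\<close>

text \<open>By injectivity only the summand at \<open>i\<close> contributes to coordinate
  \<open>\<sigma> i\<close>. Reading the result at \<open>\<sigma> i\<close> avoids the inverse
  permutation.\<close>

lemma perm_act_nth:
  fixes x :: "real ^ 'n::finite"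
  assumes "\<sigma> permutes UNIV"
  shows "perm_act \<sigma> x $ \<sigma> i = x $ i"
proof -
  have "perm_act \<sigma> x $ \<sigma> i = (\<Sum>j\<in>UNIV. if j = i then x $ j else 0)"
    unfolding perm_act_def sum_component
    by (rule sum.cong) (auto simp: axis_def inj_eq[OF permutes_inj[OF assms]])
  then show ?thesis
    by simp
qed

lemma linear_perm_act: "linear (perm_act \<sigma>)"
  unfolding perm_act_def
  by (rule linearI) (simp_all add: scaleR_add_left sum.distrib scaleR_sum_right)

lemma perm_act_axis: "perm_act \<sigma> (axis i 1) = axis (\<sigma> i) 1"
proof -
  have "perm_act \<sigma> (axis i 1) = (\<Sum>j\<in>UNIV. if j = i then axis (\<sigma> j) 1 else 0)"
    unfolding perm_act_def by (rule sum.cong) (auto simp: axis_def)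
  then show ?thesis
    by simp
qed

lemma perm_act_funpow_nth:
  fixes x :: "real ^ 'n::finite"
  assumes "\<sigma> permutes UNIV"
  shows "(perm_act \<sigma> ^^ k) x $ (\<sigma> ^^ k) i = x $ i"
  by (induction k) (simp_all add: perm_act_nth[OF assms])

text \<open>An automorphism sends edges to edges, so it maps generators to generators, and taking
  convex hulls commutes with linear maps.\<close>

lemma perm_act_SEP:
  assumes "graph_automorphism E \<sigma>" "x \<in> SEP E"
  shows "perm_act \<sigma> x \<in> SEP E"
proof -
  let ?G = "{v. \<exists>i j. {i, j} \<in> E \<and>
    (v = axis i 1 - axis j 1 \<or> v = - (axis i 1 - axis j (1::real)))}"
  have "perm_act \<sigma> ` ?G \<subseteq> ?G"
  proof (rule image_subsetI)
    fix v assume "v \<in> ?G"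
    then obtain i j where ij: "{i, j} \<in> E"
        and v: "v = axis i 1 - axis j 1 \<or> v = - (axis i 1 - axis j 1)"
      by blast
    have "{\<sigma> i, \<sigma> j} \<in> E"
      using assms(1) ij by (simp add: graph_automorphism_def)
    moreover have "perm_act \<sigma> v = axis (\<sigma> i) 1 - axis (\<sigma> j) 1 \<or>
        perm_act \<sigma> v = - (axis (\<sigma> i) 1 - axis (\<sigma> j) 1)"
      using v by (auto simp: linear_diff[OF linear_perm_act] perm_act_axis)
    ultimately show "perm_act \<sigma> v \<in> ?G"
      by blast
  qed
  then have "perm_act \<sigma> ` SEP E \<subseteq> SEP E"
    unfolding SEP_def convex_hull_linear_image[OF linear_perm_act] by (rule hull_mono)
  then show ?thesis
    using assms(2) by blast
qed

subsection \<open>Averaging over the cycles\<close>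

definition barycentre :: "'n set \<Rightarrow> real ^ 'n::finite" where
  "barycentre C = (1 / real (card C)) *\<^sub>R evec C"

text \<open>For a permutation \<open>\<sigma>\<close>, this is the projection onto the vectors that
  are constant on each cycle. The coordinate form makes the images of the basis vectors easy to
  compute.\<close>

definition orbit_average :: "('n \<Rightarrow> 'n) \<Rightarrow> real ^ 'n::finite \<Rightarrow> real ^ 'n" where
  "orbit_average \<sigma> x = (\<chi> i. (\<Sum>j\<in>orbit \<sigma> i. x $ j) / real (card (orbit \<sigma> i)))"

lemma evec_nth: "evec C $ i = (if i \<in> C then 1 else 0)"
  by (simp add: evec_def axis_def if_distrib sum.If_cases)

lemma orbit_eq_of_mem:
  fixes \<sigma> :: "'n::finite \<Rightarrow> 'n"
  assumes "\<sigma> permutes UNIV" "j \<in> orbit \<sigma> i"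
  shows "orbit \<sigma> j = orbit \<sigma> i"
  using orbit_cyclic_eq3[OF cyclic_on_orbit[OF assms(1)] assms(2)] by simp

lemma self_mem_orbit:
  fixes \<sigma> :: "'n::finite \<Rightarrow> 'n"
  assumes "\<sigma> permutes UNIV"
  shows "i \<in> orbit \<sigma> i"
  using assms by (simp add: permutation_self_in_orbit permutes_imp_permutation[OF finite])

lemma cycle_sets_disjoint:
  fixes \<sigma> :: "'n::finite \<Rightarrow> 'n"
  assumes "\<sigma> permutes UNIV" "C \<in> cycle_sets \<sigma>" "D \<in> cycle_sets \<sigma>" "C \<noteq> D"
  shows "C \<inter> D = {}"
proof (rule ccontr)
  assume "C \<inter> D \<noteq> {}"
  then obtain k where "k \<in> C" "k \<in> D"
    by blast
  then have "orbit \<sigma> k = C" "orbit \<sigma> k = D"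
    using assms(2,3) orbit_eq_of_mem[OF assms(1)] unfolding cycle_sets_def by blast+
  with assms(4) show False
    by simp
qed

lemma linear_orbit_average: "linear (orbit_average \<sigma>)"
  by (rule linearI)
    (simp_all add: orbit_average_def vec_eq_iff sum.distrib add_divide_distrib sum_distrib_left)

text \<open>Coordinate \<open>k\<close> of the average sees the single entry 1 exactly when
  \<open>i\<close> lies on the cycle of \<open>k\<close>, which is then also the cycle of
  \<open>i\<close>.\<close>

lemma orbit_average_axis:
  fixes \<sigma> :: "'n::finite \<Rightarrow> 'n"
  assumes "\<sigma> permutes UNIV"
  shows "orbit_average \<sigma> (axis i 1) = barycentre (orbit \<sigma> i)"
proof -
  have "(\<Sum>j\<in>orbit \<sigma> k. axis i 1 $ j) / real (card (orbit \<sigma> k)) =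
      1 / real (card (orbit \<sigma> i)) * (if k \<in> orbit \<sigma> i then 1 else 0)" for k
  proof (cases "k \<in> orbit \<sigma> i")
    case True
    then have "orbit \<sigma> k = orbit \<sigma> i"
      by (rule orbit_eq_of_mem[OF assms])
    then show ?thesis
      using True self_mem_orbit[OF assms, of i] by (simp add: axis_def)
  next
    case False
    then have "i \<notin> orbit \<sigma> k"
      using orbit_eq_of_mem[OF assms] self_mem_orbit[OF assms] by blast
    then show ?thesis
      using False by (simp add: axis_def)
  qed
  then show ?thesis
    by (simp add: vec_eq_iff orbit_average_def barycentre_def evec_nth)
qed

text \<open>\<open>\<sigma>\<close> maps each cycle onto itself, so the action only reindexes the
  sum over a cycle.\<close>

lemma orbit_average_perm_act:
  fixes \<sigma> :: "'n::finite \<Rightarrow> 'n"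
  assumes "\<sigma> permutes UNIV"
  shows "orbit_average \<sigma> (perm_act \<sigma> x) = orbit_average \<sigma> x"
proof -
  have "(\<Sum>j\<in>orbit \<sigma> i. perm_act \<sigma> x $ j) = (\<Sum>j\<in>orbit \<sigma> i. x $ j)" for i
  proof -
    have inj: "inj_on \<sigma> (orbit \<sigma> i)"
      using permutes_inj[OF assms] inj_on_subset by blast
    moreover have "\<sigma> ` orbit \<sigma> i \<subseteq> orbit \<sigma> i"
      by (auto intro: orbit.step)
    ultimately have "\<sigma> ` orbit \<sigma> i = orbit \<sigma> i"
      by (simp add: endo_inj_surj)
    then show ?thesis
      using sum.reindex[OF inj, of "\<lambda>j. perm_act \<sigma> x $ j"] by (simp add: perm_act_nth[OF assms])
  qed
  then show ?thesis
    by (simp add: orbit_average_def)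
qed

text \<open>A fixed vector is constant along each cycle and therefore agrees with its cycle
  means.\<close>

lemma orbit_average_fixed:
  fixes \<sigma> :: "'n::finite \<Rightarrow> 'n"
  assumes "\<sigma> permutes UNIV" "perm_act \<sigma> x = x"
  shows "orbit_average \<sigma> x = x"
proof -
  have step: "x $ \<sigma> j = x $ j" for j
    using perm_act_nth[OF assms(1), of x j] assms(2) by simp
  have const: "x $ j = x $ i" if "j \<in> orbit \<sigma> i" for i j
    using that by induction (simp_all add: step)
  have "(\<Sum>j\<in>orbit \<sigma> i. x $ j) = real (card (orbit \<sigma> i)) * x $ i" for i
    by (simp add: const)
  moreover have "card (orbit \<sigma> i) \<noteq> 0" for i
    by (simp add: orbit_nonempty)
  ultimately show ?thesis
    by (simp add: orbit_average_def vec_eq_iff)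
qed

lemma orbit_average_eq_power_average:
  fixes \<sigma> :: "'n::finite \<Rightarrow> 'n"
  assumes "\<sigma> permutes UNIV"
  obtains N where "N > 0"
    "\<And>x. orbit_average \<sigma> x = (\<Sum>k<N. (1 / real N) *\<^sub>R (perm_act \<sigma> ^^ k) x)"
    "\<And>x. perm_act \<sigma> (orbit_average \<sigma> x) = orbit_average \<sigma> x"
proof -
  let ?T = "perm_act \<sigma>"
  obtain N where N: "\<sigma> ^^ N = id" "N > 0"
    using permutation_is_nilpotent permutes_imp_permutation[OF finite assms] by blast
  define A where "A x = (\<Sum>k<N. (1 / real N) *\<^sub>R (?T ^^ k) x)" for x
  have period: "(?T ^^ N) x = x" for x
    using perm_act_funpow_nth[OF assms, of N x] N(1) by (simp add: vec_eq_iff)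
  have fixed: "?T (A x) = A x" for x
  proof -
    have "(1 / real N) *\<^sub>R x + ?T (A x) =
        (1 / real N) *\<^sub>R x + (\<Sum>k<N. (1 / real N) *\<^sub>R (?T ^^ Suc k) x)"
      by (simp add: A_def linear_sum[OF linear_perm_act] linear_cmul[OF linear_perm_act])
    also have "\<dots> = (\<Sum>k<Suc N. (1 / real N) *\<^sub>R (?T ^^ k) x)"
      by (subst sum.lessThan_Suc_shift) simp
    also have "\<dots> = (1 / real N) *\<^sub>R x + A x"
      unfolding sum.lessThan_Suc period A_def by (rule add.commute)
    finally show ?thesis
      by simp
  qed
  have "orbit_average \<sigma> ((?T ^^ k) x) = orbit_average \<sigma> x" for k x
    by (induction k) (simp_all add: orbit_average_perm_act[OF assms])
  then have "orbit_average \<sigma> (A x) = orbit_average \<sigma> x" for x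
    using N(2) unfolding A_def
    by (simp add: linear_sum[OF linear_orbit_average] linear_cmul[OF linear_orbit_average]
        sum_constant_scaleR del: sum_constant)
  then have eq: "orbit_average \<sigma> x = A x" for x
    using orbit_average_fixed[OF assms fixed, of x] by simp
  show ?thesis
  proof (rule that[OF N(2)])
    show "orbit_average \<sigma> x = (\<Sum>k<N. (1 / real N) *\<^sub>R (?T ^^ k) x)" for x
      by (simp only: eq A_def)
    show "?T (orbit_average \<sigma> x) = orbit_average \<sigma> x" for x
      by (simp only: eq fixed)
  qed
qed

lemma fixed_polytope_SEP:
  assumes "graph_automorphism E \<sigma>"
  shows "fixed_polytope (SEP E) \<sigma> = orbit_average \<sigma> ` SEP E"
proof -
  have perm: "\<sigma> permutes UNIV"
    using assms by (simp add: graph_automorphism_def)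
  obtain N where N: "N > 0"
    and avg: "\<And>x. orbit_average \<sigma> x = (\<Sum>k<N. (1 / real N) *\<^sub>R (perm_act \<sigma> ^^ k) x)"
    and fixed: "\<And>x. perm_act \<sigma> (orbit_average \<sigma> x) = orbit_average \<sigma> x"
    using orbit_average_eq_power_average[OF perm] by blast
  have "orbit_average \<sigma> x \<in> SEP E" if "x \<in> SEP E" for x
  proof -
    have "(perm_act \<sigma> ^^ k) x \<in> SEP E" for k
      by (induction k) (simp_all add: that perm_act_SEP[OF assms])
    moreover have "convex (SEP E)"
      by (simp add: SEP_def)
    ultimately show ?thesis
      unfolding avg using N by (intro convex_sum) simp_all
  qed
  moreover have "x \<in> orbit_average \<sigma> ` SEP E" if "x \<in> SEP E" "perm_act \<sigma> x = x" for x
    using that orbit_average_fixed[OF perm] by (metis imageI)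
  ultimately show ?thesis
    using fixed by (auto simp: fixed_polytope_def)
qed

subsection \<open>The vertices\<close>

definition cycle_differences :: "'n::finite set set \<Rightarrow> ('n \<Rightarrow> 'n) \<Rightarrow> (real ^ 'n) set" where
  "cycle_differences E \<sigma> = {barycentre C - barycentre D | C D.
     C \<in> cycle_sets \<sigma> \<and> D \<in> cycle_sets \<sigma> \<and> C \<noteq> D \<and> joined E C D}"

lemma joined_sym: "joined E C D \<Longrightarrow> joined E D C"
  unfolding joined_def by (metis insert_commute)

lemma uminus_cycle_differences:
  assumes "w \<in> cycle_differences E \<sigma>"
  shows "- w \<in> cycle_differences E \<sigma>"
proof -
  obtain C D where "C \<in> cycle_sets \<sigma>" "D \<in> cycle_sets \<sigma>" "C \<noteq> D" "joined E C D"
    and w: "w = barycentre C - barycentre D"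
    using assms unfolding cycle_differences_def by blast
  moreover from w have "- w = barycentre D - barycentre C"
    by simp
  ultimately show ?thesis
    unfolding cycle_differences_def using joined_sym by blast
qed

lemma zero_mem_hull_cycle_differences:
  assumes "cycle_differences E \<sigma> \<noteq> {}"
  shows "0 \<in> convex hull (cycle_differences E \<sigma>)"
proof -
  obtain w where w: "w \<in> cycle_differences E \<sigma>"
    using assms by blast
  then have "(1/2) *\<^sub>R w + (1/2) *\<^sub>R (- w) \<in> convex hull (cycle_differences E \<sigma>)"
    by (intro convexD convex_convex_hull hull_inc uminus_cycle_differences) simp_all
  then show ?thesis
    by simp
qed

lemma fixed_polytope_SEP_eq_hull:
  assumes aut: "graph_automorphism E \<sigma>"
    and ne: "E = {} \<or> cycle_differences E \<sigma> \<noteq> {}"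
  shows "fixed_polytope (SEP E) \<sigma> = convex hull (cycle_differences E \<sigma>)"
proof -
  let ?W = "cycle_differences E \<sigma>"
  let ?G = "{v. \<exists>i j. {i, j} \<in> E \<and>
    (v = axis i 1 - axis j 1 \<or> v = - (axis i 1 - axis j (1::real)))}"
  have perm: "\<sigma> permutes UNIV"
    using aut by (simp add: graph_automorphism_def)
  have avg: "orbit_average \<sigma> (axis i 1 - axis j 1) = barycentre (orbit \<sigma> i) - barycentre (orbit \<sigma> j)"
    for i j
    by (simp add: linear_diff[OF linear_orbit_average] orbit_average_axis[OF perm])
  have "orbit_average \<sigma> v \<in> convex hull ?W" if v: "v \<in> ?G" for v
  proof -
    obtain i j where ij: "{i, j} \<in> E" "v = axis i 1 - axis j 1"
    proof -
      obtain a b where "{a, b} \<in> E" "v = axis a 1 - axis b 1 \<or> v = - (axis a 1 - axis b 1)"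
        using v by blast
      moreover from this have "{b, a} \<in> E"
        by (simp add: insert_commute)
      ultimately show thesis
        using that[of a b] that[of b a] by auto
    qed
    show ?thesis
    proof (cases "orbit \<sigma> i = orbit \<sigma> j")
      case True
      then show ?thesis
        using ij ne zero_mem_hull_cycle_differences by (auto simp: avg)
    next
      case False
      moreover have "joined E (orbit \<sigma> i) (orbit \<sigma> j)"
        using ij self_mem_orbit[OF perm] unfolding joined_def by blast
      ultimately have "orbit_average \<sigma> v \<in> ?W"
        unfolding ij avg cycle_differences_def cycle_sets_def by blast
      then show ?thesis
        by (rule hull_inc)
    qed
  qed
  then have "convex hull (orbit_average \<sigma> ` ?G) \<subseteq> convex hull ?W"
    by (intro hull_minimal) auto
  moreover have "?W \<subseteq> orbit_average \<sigma> ` ?G"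
  proof
    fix w assume "w \<in> ?W"
    then obtain i j a b where w: "w = barycentre (orbit \<sigma> i) - barycentre (orbit \<sigma> j)"
      and ab: "a \<in> orbit \<sigma> i" "b \<in> orbit \<sigma> j" "{a, b} \<in> E"
      unfolding cycle_differences_def cycle_sets_def joined_def by blast
    have "w = orbit_average \<sigma> (axis a 1 - axis b 1)"
      using ab orbit_eq_of_mem[OF perm] by (simp add: avg w)
    then show "w \<in> orbit_average \<sigma> ` ?G"
      using ab(3) by blast
  qed
  then have "convex hull ?W \<subseteq> convex hull (orbit_average \<sigma> ` ?G)"
    by (rule hull_mono)
  ultimately show ?thesis
    unfolding fixed_polytope_SEP[OF aut] unfolding SEP_def
      convex_hull_linear_image[OF linear_orbit_average]
    by (rule subset_antisym)
qed

lemma inner_evec_barycentre: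
  fixes \<sigma> :: "'n::finite \<Rightarrow> 'n"
  assumes "\<sigma> permutes UNIV" "C \<in> cycle_sets \<sigma>" "D \<in> cycle_sets \<sigma>"
  shows "evec C \<bullet> barycentre D = (if C = D then 1 else 0)"
proof -
  have "evec C \<bullet> evec D = (\<Sum>i\<in>UNIV. if i \<in> C \<inter> D then 1 else 0 :: real)"
    unfolding inner_vec_def by (rule sum.cong) (auto simp: evec_nth)
  also have "\<dots> = real (card (C \<inter> D))"
    by (simp add: sum.If_cases Collect_conj_eq)
  finally have "evec C \<bullet> barycentre D = real (card (C \<inter> D)) / real (card D)"
    by (simp add: barycentre_def)
  moreover have "card D \<noteq> 0"
    using assms(3) by (auto simp: cycle_sets_def orbit_nonempty)
  ultimately show ?thesis
    using cycle_sets_disjoint[OF assms] by auto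
qed

lemma cycle_differences_convex_independent:
  fixes \<sigma> :: "'n::finite \<Rightarrow> 'n"
  assumes perm: "\<sigma> permutes UNIV" and w: "w \<in> cycle_differences E \<sigma>"
  shows "w \<notin> convex hull (cycle_differences E \<sigma> - {w})"
proof -
  obtain C D where CD: "C \<in> cycle_sets \<sigma>" "D \<in> cycle_sets \<sigma>" "C \<noteq> D"
    and w_eq: "w = barycentre C - barycentre D"
    using w unfolding cycle_differences_def by blast
  let ?f = "evec C - evec D"
  have "cycle_differences E \<sigma> - {w} \<subseteq> {x. ?f \<bullet> x < 2}"
  proof
    fix v assume v: "v \<in> cycle_differences E \<sigma> - {w}"
    then obtain C' D' where CD': "C' \<in> cycle_sets \<sigma>" "D' \<in> cycle_sets \<sigma>" "C' \<noteq> D'"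
      and v_eq: "v = barycentre C' - barycentre D'"
      unfolding cycle_differences_def by blast
    have "\<not> (C' = C \<and> D' = D)"
      using v v_eq w_eq by auto
    then show "v \<in> {x. ?f \<bullet> x < 2}"
      using CD CD' by (auto simp: v_eq inner_diff_left inner_diff_right inner_evec_barycentre[OF perm])
  qed
  then have "convex hull (cycle_differences E \<sigma> - {w}) \<subseteq> {x. ?f \<bullet> x < 2}"
    by (intro hull_minimal convex_halfspace_lt)
  moreover have "?f \<bullet> w = 2"
    using CD by (simp add: w_eq inner_diff_left inner_diff_right inner_evec_barycentre[OF perm])
  ultimately show ?thesis
    by auto
qed

lemma finite_cycle_differences: "finite (cycle_differences E \<sigma>)"
proof (rule finite_subset)
  show "cycle_differences E \<sigma> \<subseteq> (\<lambda>(C, D). barycentre C - barycentre D) ` UNIV"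
    unfolding cycle_differences_def by auto
qed simp

theorem theorem4p3:
  fixes E :: "'n::finite set set" and \<sigma> :: "'n \<Rightarrow> 'n"
  assumes "simple_graph E"
    and "graph_automorphism E \<sigma>"
    and "E = {} \<or> (\<exists>C\<in>cycle_sets \<sigma>. \<exists>D\<in>cycle_sets \<sigma>. C \<noteq> D \<and> joined E C D)"
  shows "vertex_set (fixed_polytope (SEP E) \<sigma>) =
    {(1 / real (card C)) *\<^sub>R evec C - (1 / real (card D)) *\<^sub>R evec D | C D.
       C \<in> cycle_sets \<sigma> \<and> D \<in> cycle_sets \<sigma> \<and> C \<noteq> D \<and> joined E C D}"
proof -
  have perm: "\<sigma> permutes UNIV"
    using assms(2) by (simp add: graph_automorphism_def)
  have "E = {} \<or> cycle_differences E \<sigma> \<noteq> {}"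
    using assms(3) unfolding cycle_differences_def by blast
  then have "fixed_polytope (SEP E) \<sigma> = convex hull (cycle_differences E \<sigma>)"
    by (rule fixed_polytope_SEP_eq_hull[OF assms(2)])
  moreover have "v extreme_point_of convex hull (cycle_differences E \<sigma>) \<longleftrightarrow>
      v \<in> cycle_differences E \<sigma>" for v
    by (intro extreme_point_of_convex_hull_convex_independent finite_imp_compact
        finite_cycle_differences cycle_differences_convex_independent[OF perm])
  ultimately have "vertex_set (fixed_polytope (SEP E) \<sigma>) = cycle_differences E \<sigma>"
    by (simp add: vertex_set_def)
  then show ?thesis
    by (simp add: cycle_differences_def barycentre_def)
qed

end
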